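(* Let $\mathcal{G}$ be a locally compact abelian group with dual group $\hat{\mathcal{G}}$, let $w$ be a submultiplicative weight on $\hat{\mathcal{G}}$ satisfying the Beurling–Domar condition and $w^{-1}\in L^2(\hat{\mathcal{G}})$, and let $\phi=\mathcal{F}^{-1}(w^{-2})$. Let $\Lambda$ be a lattice in $\mathcal{G}$, and let $\Lambda_1\subseteq\Lambda_2\subseteq\cdots$ be finite subsets of $\Lambda$ with $\bigcup_n\Lambda_n=\Lambda$. Let $P_n$ be the orthogonal projection of $\mathcal{H}_w(\mathcal{G})$ onto $V_n=\operatorname{span}\{T_\lambda\phi:\lambda\in\Lambda_n\}$. Let $c=(c_\lambda)\in\ell^2(\Lambda)$, let $g$ be the element of minimal norm in $\{f\in\mathcal{H}_w(\mathcal{G}): f(\lambda)=c_\lambda\ \forall\lambda\in\Lambda\}$, and let $g_n$ be the element of minimal norm in $\{f\in\mathcal{H}_w(\mathcal{G}): f(\lambda)=c_\lambda\ \forall\lambda\in\Lambda_n\}$. Then $g_n=P_ng$ for every $n$, and $$\|g-g_n\|_w\to0\quad\text{as } n\to\infty.$$ Moreover $g_n\to g$ also in the sup-norm on $\mathcal{G}$.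
   Context: Conventions. $\mathcal{G}$ is a locally compact abelian group (written additively), and $\hat{\mathcal{G}}$ is its dual group (also written additively). The pairing is $\langle \gamma,x\rangle=\langle x,\gamma\rangle=\gamma(x)$. Haar measures $dx$, $d\gamma$ are normalized so that Fourier inversion and Plancherel hold, with $\mathcal{F}f(\gamma)=\hat f(\gamma)=\int_{\mathcal{G}} f(x)\overline{\gamma(x)}\,dx$ and $\mathcal{F}^{-1}h(x)=\int_{\hat{\mathcal{G}}}h(\gamma)\langle\gamma,x\rangle\,d\gamma$. Translation: $T_xf(y)=f(y-x)$. Weights. A submultiplicative weight is a strictly positive continuous function $w$ on $\hat{\mathcal{G}}$ with $w(\gamma_1+\gamma_2)\le w(\gamma_1)w(\gamma_2)$ for all $\gamma_1,\gamma_2\in\hat{\mathcal{G}}$. The Beurling–Domar condition is $\sum_{n=1}^\infty n^{-2}\log w(n\gamma)<\infty$ for all $\gamma\in\hat{\mathcal{G}}$. Harmonic Hilbert space. $L^2_w(\hat{\mathcal{G}})$ is the space of measurable $h$ with $hw\in L^2(\hat{\mathcal{G}})$; $\mathcal{H}_w(\mathcal{G})=\mathcal{F}^{-1}L^2_w(\hat{\mathcal{G}})$ with inner product $\langle f,g\rangle_w=\int_{\hat{\mathcal{G}}}\hat f(\gamma)\overline{\hat g(\gamma)}w^2(\gamma)\,d\gamma$ and norm $\|\cdot\|_w$. Since $w^{-1}\in L^2$, we have $L^2_w\subset L^1$ and elements of $\mathcal{H}_w(\mathcal{G})$ are continuous functions. Lattice. A lattice $\Lambda$ in $\mathcal{G}$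 is a discrete subgroup such that $\mathcal{G}/\Lambda$ is compact. Lattices in $\mathcal{G}$ and $\hat{\mathcal{G}}$ (in particular $\Lambda$ and its annihilator $\Lambda^\perp=\{\chi\in\hat{\mathcal{G}}:\chi(\lambda)=1\ \forall\lambda\in\Lambda\}$) are assumed countable. Under these assumptions the minimal norm interpolants $g$ and $g_n$ exist and are unique. *)

theory Defs
  imports "HOL-Analysis.Analysis"
begin

section \<open>The dual group\<close>

text \<open>The group operation of \<^typ>\<open>'g\<close> is written additively; a character is a continuous
  homomorphism into the unit circle.\<close>

typedef (overloaded) ('g::topological_ab_group_add) dual =
  "{\<xi>. continuous_on UNIV (\<xi> :: 'g \<Rightarrow> complex) \<and> (\<forall>x. cmod (\<xi> x) = 1) \<and>
      (\<forall>x y. \<xi> (x + y) = \<xi> x * \<xi> y)}"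
  morphisms char_at Abs_dual
  by (rule exI[of _ "\<lambda>_. 1"]) auto

lemma continuous_char_at: "continuous_on UNIV (char_at \<gamma>)"
  and norm_char_at [simp]: "cmod (char_at \<gamma> x) = 1"
  and char_at_add: "char_at \<gamma> (x + y) = char_at \<gamma> x * char_at \<gamma> y"
  using char_at[of \<gamma>] by auto

instantiation dual :: (topological_ab_group_add) ab_group_add
begin

definition "0 = Abs_dual (\<lambda>_. 1)"
definition "\<gamma> + \<delta> = Abs_dual (\<lambda>x. char_at \<gamma> x * char_at \<delta> x)"
definition "- \<gamma> = Abs_dual (\<lambda>x. cnj (char_at \<gamma> x))"
definition "\<gamma> - \<delta> = \<gamma> + - (\<delta> :: 'a dual)"

lemma char_at_zero: "char_at (0 :: 'a dual) x = 1"
  by (simp add: zero_dual_def Abs_dual_inverse)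

lemma char_at_plus: "char_at (\<gamma> + \<delta> :: 'a dual) x = char_at \<gamma> x * char_at \<delta> x"
  by (simp add: plus_dual_def Abs_dual_inverse norm_mult char_at_add continuous_char_at
      continuous_on_mult mult_ac)

lemma char_at_uminus: "char_at (- \<gamma> :: 'a dual) x = cnj (char_at \<gamma> x)"
  by (simp add: uminus_dual_def Abs_dual_inverse char_at_add continuous_char_at continuous_on_cnj)

instance
proof
  fix \<alpha> \<beta> \<gamma> :: "'a dual"
  have eqI: "\<And>\<mu> \<nu> :: 'a dual. (\<And>x. char_at \<mu> x = char_at \<nu> x) \<Longrightarrow> \<mu> = \<nu>"
    by (meson char_at_inject ext)
  show "\<alpha> + \<beta> + \<gamma> = \<alpha> + (\<beta> + \<gamma>)" by (rule eqI) (simp add: char_at_plus)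
  show "\<alpha> + \<beta> = \<beta> + \<alpha>" by (rule eqI) (simp add: char_at_plus)
  show "0 + \<alpha> = \<alpha>" by (rule eqI) (simp add: char_at_plus char_at_zero)
  show "- \<alpha> + \<alpha> = 0"
  proof (rule eqI)
    fix x
    have "char_at \<alpha> x * cnj (char_at \<alpha> x) = 1"
      by (metis norm_char_at complex_norm_square of_real_1 power_one)
    then show "char_at (- \<alpha> + \<alpha>) x = char_at 0 x"
      by (simp add: char_at_plus char_at_uminus char_at_zero mult.commute)
  qed
  show "\<alpha> - \<beta> = \<alpha> + - \<beta>" by (rule minus_dual_def)
qed

end

text \<open>The dual group carries the compact-open topology.\<close>

instantiation dual :: (topological_ab_group_add) topological_space
begin

definition open_dual :: "'a dual set \<Rightarrow> bool" where
  "open_dual = generate_topology {S. \<exists>K U. compact K \<and> open U \<and> S = {\<gamma>. char_at \<gamma> ` K \<subseteq> U}}"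

instance
proof
  show "open (UNIV :: 'a dual set)"
    unfolding open_dual_def by (rule generate_topology.UNIV)
next
  fix S T :: "'a dual set"
  assume "open S" "open T"
  then show "open (S \<inter> T)" unfolding open_dual_def by (rule generate_topology.Int)
next
  fix \<K> :: "'a dual set set"
  assume "\<forall>S\<in>\<K>. open S"
  then show "open (\<Union>\<K>)" unfolding open_dual_def by (intro generate_topology.UN) auto
qed

end

section \<open>Haar measures and the Fourier transform\<close>

text \<open>A Haar measure is a nonzero translation-invariant Radon measure on the Borel sets.\<close>

definition haar_measure :: "('a::{topological_space,ab_group_add}) measure \<Rightarrow> bool" where
  "haar_measure M \<longleftrightarrow>
     sets M = sets borel \<and>
     emeasure M UNIV \<noteq> 0 \<and>
     (\<forall>K. compact K \<longrightarrow> emeasure M K < \<infinity>) \<and>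
     (\<forall>A\<in>sets M. emeasure M A = (INF U\<in>{U. open U \<and> A \<subseteq> U}. emeasure M U)) \<and>
     (\<forall>U. open U \<longrightarrow> emeasure M U = (SUP K\<in>{K. compact K \<and> K \<subseteq> U}. emeasure M K)) \<and>
     (\<forall>A\<in>sets M. \<forall>x. emeasure M ((+) x ` A) = emeasure M A)"

definition L1 :: "'a measure \<Rightarrow> ('a \<Rightarrow> complex) set" where
  "L1 M = {f. integrable M f}"

definition L2 :: "'a measure \<Rightarrow> ('a \<Rightarrow> complex) set" where
  "L2 M = {f \<in> borel_measurable M. integrable M (\<lambda>x. (cmod (f x))\<^sup>2)}"

definition fourier ::
    "('g::topological_ab_group_add) measure \<Rightarrow> ('g \<Rightarrow> complex) \<Rightarrow> 'g dual \<Rightarrow> complex" where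
  "fourier \<mu> f \<gamma> = (\<integral>x. f x * cnj (char_at \<gamma> x) \<partial>\<mu>)"

definition inv_fourier ::
    "('g::topological_ab_group_add) dual measure \<Rightarrow> ('g dual \<Rightarrow> complex) \<Rightarrow> 'g \<Rightarrow> complex" where
  "inv_fourier \<nu> h x = (\<integral>\<gamma>. h \<gamma> * char_at \<gamma> x \<partial>\<nu>)"

text \<open>For every Haar measure on a locally compact abelian group there is exactly one Haar measure
  on the dual group for which the inversion formula and the two Plancherel identities below hold.\<close>

definition fourier_normalized ::
    "('g::topological_ab_group_add) measure \<Rightarrow> 'g dual measure \<Rightarrow> bool" where
  "fourier_normalized \<mu> \<nu> \<longleftrightarrow>
     (\<forall>f\<in>L1 \<mu>. fourier \<mu> f \<in> L1 \<nu> \<longrightarrow> (AE x in \<mu>. inv_fourier \<nu> (fourier \<mu> f) x = f x)) \<and>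
     (\<forall>f\<in>L1 \<mu> \<inter> L2 \<mu>. fourier \<mu> f \<in> L2 \<nu> \<and>
        (\<integral>\<gamma>. (cmod (fourier \<mu> f \<gamma>))\<^sup>2 \<partial>\<nu>) = (\<integral>x. (cmod (f x))\<^sup>2 \<partial>\<mu>)) \<and>
     (\<forall>h\<in>L1 \<nu> \<inter> L2 \<nu>. inv_fourier \<nu> h \<in> L2 \<mu> \<and>
        (\<integral>x. (cmod (inv_fourier \<nu> h x))\<^sup>2 \<partial>\<mu>) = (\<integral>\<gamma>. (cmod (h \<gamma>))\<^sup>2 \<partial>\<nu>))"

section \<open>Weights\<close>

definition submultiplicative_weight :: "('a::{topological_space,ab_group_add} \<Rightarrow> real) \<Rightarrow> bool"
  where "submultiplicative_weight w \<longleftrightarrow>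
     continuous_on UNIV w \<and> (\<forall>\<gamma>. w \<gamma> > 0) \<and> (\<forall>\<gamma> \<delta>. w (\<gamma> + \<delta>) \<le> w \<gamma> * w \<delta>)"

text \<open>The multiple \<open>n\<gamma>\<close> is written as an \<open>n\<close>-fold sum; the series is indexed from
  \<open>n = 1\<close> via \<^const>\<open>Suc\<close>.\<close>

definition beurling_domar :: "('a::ab_group_add \<Rightarrow> real) \<Rightarrow> bool" where
  "beurling_domar w \<longleftrightarrow>
     (\<forall>\<gamma>. summable (\<lambda>n. ln (w (\<Sum>_<Suc n. \<gamma>)) / (real (Suc n))\<^sup>2))"

section \<open>Harmonic Hilbert spaces\<close>

definition weighted_L2 :: "'a measure \<Rightarrow> ('a \<Rightarrow> real) \<Rightarrow> ('a \<Rightarrow> complex) set" where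
  "weighted_L2 M w = {h \<in> borel_measurable M. (\<lambda>\<gamma>. h \<gamma> * of_real (w \<gamma>)) \<in> L2 M}"

definition harmonic_space ::
    "('g::topological_ab_group_add) dual measure \<Rightarrow> ('g dual \<Rightarrow> real) \<Rightarrow> ('g \<Rightarrow> complex) set" where
  "harmonic_space \<nu> w = inv_fourier \<nu> ` weighted_L2 \<nu> w"

text \<open>A function \<open>f\<close> in the harmonic space need not be integrable, so its Fourier transform is
  not given by the integral \<^const>\<open>fourier\<close>; it is the element of the weighted \<open>L\<^sup>2\<close> space,
  unique up to null sets, whose inverse transform is \<open>f\<close>.\<close>

definition harmonic_hat ::
    "('g::topological_ab_group_add) dual measure \<Rightarrow> ('g dual \<Rightarrow> real) \<Rightarrow> ('g \<Rightarrow> complex) \<Rightarrow>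
      'g dual \<Rightarrow> complex" where
  "harmonic_hat \<nu> w f = (SOME h. h \<in> weighted_L2 \<nu> w \<and> inv_fourier \<nu> h = f)"

definition harmonic_inner ::
    "('g::topological_ab_group_add) dual measure \<Rightarrow> ('g dual \<Rightarrow> real) \<Rightarrow> ('g \<Rightarrow> complex) \<Rightarrow>
      ('g \<Rightarrow> complex) \<Rightarrow> complex" where
  "harmonic_inner \<nu> w f g =
     (\<integral>\<gamma>. harmonic_hat \<nu> w f \<gamma> * cnj (harmonic_hat \<nu> w g \<gamma>) * of_real ((w \<gamma>)\<^sup>2) \<partial>\<nu>)"

definition harmonic_norm ::
    "('g::topological_ab_group_add) dual measure \<Rightarrow> ('g dual \<Rightarrow> real) \<Rightarrow> ('g \<Rightarrow> complex) \<Rightarrow> real" where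
  "harmonic_norm \<nu> w f = sqrt (Re (harmonic_inner \<nu> w f f))"

text \<open>The orthogonal projection of \<open>f\<close> onto a finite-dimensional subspace \<open>V\<close>.\<close>

definition harmonic_proj ::
    "('g::topological_ab_group_add) dual measure \<Rightarrow> ('g dual \<Rightarrow> real) \<Rightarrow> ('g \<Rightarrow> complex) set \<Rightarrow>
      ('g \<Rightarrow> complex) \<Rightarrow> 'g \<Rightarrow> complex" where
  "harmonic_proj \<nu> w V f =
     (THE p. p \<in> V \<and> (\<forall>v\<in>V. harmonic_inner \<nu> w (\<lambda>x. f x - p x) v = 0))"

definition translate :: "('g::ab_group_add) \<Rightarrow> ('g \<Rightarrow> complex) \<Rightarrow> 'g \<Rightarrow> complex" where
  "translate x f y = f (y - x)"

text \<open>The complex linear span of \<open>{T\<^sub>\<lambda> \<phi> : \<lambda> \<in> A}\<close>, for finite \<open>A\<close>.\<close>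

definition translate_span :: "('g::ab_group_add) set \<Rightarrow> ('g \<Rightarrow> complex) \<Rightarrow> ('g \<Rightarrow> complex) set" where
  "translate_span A \<phi> = range (\<lambda>a x. \<Sum>l\<in>A. a l * translate l \<phi> x)"

text \<open>The elements of minimal norm among the functions in the harmonic space that agree with
  \<open>c\<close> on \<open>A\<close>.\<close>

definition min_norm_interpolant ::
    "('g::topological_ab_group_add) dual measure \<Rightarrow> ('g dual \<Rightarrow> real) \<Rightarrow> 'g set \<Rightarrow>
      ('g \<Rightarrow> complex) \<Rightarrow> ('g \<Rightarrow> complex) \<Rightarrow> bool" where
  "min_norm_interpolant \<nu> w A c g \<longleftrightarrow>
     is_arg_min (harmonic_norm \<nu> w) (\<lambda>f. f \<in> harmonic_space \<nu> w \<and> (\<forall>l\<in>A. f l = c l)) g"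

section \<open>Lattices\<close>

definition coset :: "('g::ab_group_add) set \<Rightarrow> 'g \<Rightarrow> 'g set" where
  "coset \<Lambda> x = (+) x ` \<Lambda>"

definition quotient_topology :: "('g::{topological_space,ab_group_add}) set \<Rightarrow> 'g set topology" where
  "quotient_topology \<Lambda> = topology (\<lambda>U. U \<subseteq> range (coset \<Lambda>) \<and> open (coset \<Lambda> -` U))"

lemma openin_quotient_topology:
  "openin (quotient_topology \<Lambda>) U \<longleftrightarrow> U \<subseteq> range (coset \<Lambda>) \<and> open (coset \<Lambda> -` U)"
proof -
  have "istopology (\<lambda>U. U \<subseteq> range (coset \<Lambda>) \<and> open (coset \<Lambda> -` U))"
    unfolding istopology_def
    by (auto simp: vimage_Union)
  then show ?thesis unfolding quotient_topology_def by (simp add: topology_inverse')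
qed

definition lattice_in :: "('g::{topological_space,ab_group_add}) set \<Rightarrow> bool" where
  "lattice_in \<Lambda> \<longleftrightarrow>
     0 \<in> \<Lambda> \<and> (\<forall>x\<in>\<Lambda>. \<forall>y\<in>\<Lambda>. x + y \<in> \<Lambda>) \<and> (\<forall>x\<in>\<Lambda>. - x \<in> \<Lambda>) \<and>
     discrete \<Lambda> \<and> compact_space (quotient_topology \<Lambda>)"

definition annihilator :: "('g::topological_ab_group_add) set \<Rightarrow> 'g dual set" where
  "annihilator \<Lambda> = {\<xi>. \<forall>l\<in>\<Lambda>. char_at \<xi> l = 1}"

end

theory Submission
  imports Defs
begin

text \<open>
  The map \<open>u \<mapsto> \<F>\<^sup>-\<^sup>1(u / w)\<close> identifies \<open>L\<^sup>2\<close> of the dual group with the harmonic space. The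
  Beurling--Domar condition forces \<open>w \<ge> 1\<close> (\<open>beurling_domar_weight_ge_1\<close>), so \<open>u / w\<close> is both
  integrable and square-integrable, and Plancherel's theorem makes the map injective up to null sets
  (\<open>synth_inj\<close>) and isometric (\<open>harmonic_inner_synth\<close>). Under this identification the value of a
  function at \<open>x\<close> is an inner product with a kernel, whose image is the translate \<open>T\<^sub>x \<phi>\<close>, and
  whose norm does not depend on \<open>x\<close>. Hence the harmonic norm dominates the sup-norm
  (\<open>norm_synth_le\<close>).

  A minimal norm interpolant on a set \<open>A\<close> is orthogonal to everything that vanishes on \<open>A\<close>
  (\<open>min_norm_interpolantD\<close>); for finite \<open>A\<close> it therefore lies in the span of the translates
  (\<open>min_norm_interpolant_in_span\<close>). As \<open>g - g\<^sub>n\<close> vanishes on \<open>\<Lambda>\<^sub>n\<close>, it is orthogonal to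
  \<open>V\<^sub>n\<close>, which makes \<open>g\<^sub>n\<close> the projection of \<open>g\<close> (\<open>harmonic_proj_eqI\<close>).

  The same orthogonality makes \<open>\<parallel>g\<^sub>n\<parallel>\<^sup>2\<close> increasing and bounded with increments
  \<open>\<parallel>g\<^sub>m - g\<^sub>n\<parallel>\<^sup>2\<close>. So \<open>g\<^sub>n\<close> is a Cauchy sequence, and the completeness of \<open>L\<^sup>2\<close>
  (\<open>L2_complete\<close>) supplies a limit, which interpolates on all of \<open>\<Lambda>\<close> and is orthogonal to
  whatever vanishes there, so it equals \<open>g\<close> (\<open>l2_interpolants_converge\<close>).
\<close>

section \<open>Square-integrable functions as a semi-inner product space\<close>

definition l2_inner :: "'a measure \<Rightarrow> ('a \<Rightarrow> complex) \<Rightarrow> ('a \<Rightarrow> complex) \<Rightarrow> complex" where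
  "l2_inner M u v = (\<integral>x. u x * cnj (v x) \<partial>M)"

definition l2_sq :: "'a measure \<Rightarrow> ('a \<Rightarrow> complex) \<Rightarrow> real" where
  "l2_sq M u = (\<integral>x. (cmod (u x))\<^sup>2 \<partial>M)"

lemma L2_measurable: "u \<in> L2 M \<Longrightarrow> u \<in> borel_measurable M"
  by (simp add: L2_def)

lemma L2_integrable: "u \<in> L2 M \<Longrightarrow> integrable M (\<lambda>x. (cmod (u x))\<^sup>2)"
  by (simp add: L2_def)

lemma L2_integrable_mult:
  assumes "u \<in> L2 M" "v \<in> L2 M"
  shows "integrable M (\<lambda>x. u x * v x)"
proof (rule Bochner_Integration.integrable_bound)
  show "integrable M (\<lambda>x. (cmod (u x))\<^sup>2 + (cmod (v x))\<^sup>2)"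
    using assms by (intro Bochner_Integration.integrable_add L2_integrable)
  show "(\<lambda>x. u x * v x) \<in> borel_measurable M"
    using assms by (intro borel_measurable_times L2_measurable)
  have "a * b \<le> \<bar>a\<^sup>2 + b\<^sup>2\<bar>" if "a \<ge> 0" "b \<ge> 0" for a b :: real
    using sum_squares_bound[of a b] mult_nonneg_nonneg[OF that] by (simp add: abs_of_nonneg)
  then show "AE x in M. cmod (u x * v x) \<le> norm ((cmod (u x))\<^sup>2 + (cmod (v x))\<^sup>2)"
    by (simp add: norm_mult)
qed

lemma L2_cnj: "u \<in> L2 M \<Longrightarrow> (\<lambda>x. cnj (u x)) \<in> L2 M"
  by (auto simp: L2_def intro!: borel_measurable_continuous_on[of cnj] continuous_on_cnj)

lemma l2_inner_integrable:
  "u \<in> L2 M \<Longrightarrow> v \<in> L2 M \<Longrightarrow> integrable M (\<lambda>x. u x * cnj (v x))"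
  by (intro L2_integrable_mult L2_cnj)

lemma L2_scale: "u \<in> L2 M \<Longrightarrow> (\<lambda>x. a * u x) \<in> L2 M"
  by (auto simp: L2_def norm_mult power_mult_distrib)

lemma L2_add:
  assumes "u \<in> L2 M" "v \<in> L2 M"
  shows "(\<lambda>x. u x + v x) \<in> L2 M"
proof -
  have "integrable M (\<lambda>x. (cmod (u x + v x))\<^sup>2)"
  proof (rule Bochner_Integration.integrable_bound)
    show "integrable M (\<lambda>x. 2 * (cmod (u x))\<^sup>2 + 2 * (cmod (v x))\<^sup>2)"
      using assms by (intro Bochner_Integration.integrable_add integrable_mult_right L2_integrable)
    show "(\<lambda>x. (cmod (u x + v x))\<^sup>2) \<in> borel_measurable M"
      using assms[THEN L2_measurable] by simp
    have "(cmod (a + b))\<^sup>2 \<le> 2 * (cmod a)\<^sup>2 + 2 * (cmod b)\<^sup>2" for a b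
    proof -
      have "(cmod (a + b))\<^sup>2 \<le> (cmod a + cmod b)\<^sup>2"
        by (intro power_mono norm_triangle_ineq) simp
      also have "\<dots> \<le> 2 * (cmod a)\<^sup>2 + 2 * (cmod b)\<^sup>2"
        using sum_squares_bound[of "cmod a" "cmod b"] by (simp add: power2_sum)
      finally show ?thesis .
    qed
    then show "AE x in M. norm ((cmod (u x + v x))\<^sup>2) \<le> norm (2 * (cmod (u x))\<^sup>2 + 2 * (cmod (v x))\<^sup>2)"
      by simp
  qed
  then show ?thesis using assms by (auto simp: L2_def intro: borel_measurable_add)
qed

lemma L2_diff: "u \<in> L2 M \<Longrightarrow> v \<in> L2 M \<Longrightarrow> (\<lambda>x. u x - v x) \<in> L2 M"
  using L2_add[of u M "\<lambda>x. (-1) * v x"] L2_scale[of v M "-1"] by simp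

lemma L2_sum: "(\<And>i. i \<in> A \<Longrightarrow> f i \<in> L2 M) \<Longrightarrow> (\<lambda>x. \<Sum>i\<in>A. f i x) \<in> L2 M"
  by (induction A rule: infinite_finite_induct) (auto simp: L2_add, auto simp: L2_def)

lemma l2_inner_diff_left:
  "u \<in> L2 M \<Longrightarrow> v \<in> L2 M \<Longrightarrow> e \<in> L2 M \<Longrightarrow>
    l2_inner M (\<lambda>x. u x - v x) e = l2_inner M u e - l2_inner M v e"
  by (simp add: l2_inner_def left_diff_distrib l2_inner_integrable)

lemma l2_inner_scale_left: "l2_inner M (\<lambda>x. a * u x) e = a * l2_inner M u e"
  by (simp add: l2_inner_def mult.assoc)

lemma l2_inner_sum_left:
  "(\<And>i. i \<in> A \<Longrightarrow> f i \<in> L2 M) \<Longrightarrow> e \<in> L2 M \<Longrightarrow>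
    l2_inner M (\<lambda>x. \<Sum>i\<in>A. f i x) e = (\<Sum>i\<in>A. l2_inner M (f i) e)"
  by (simp add: l2_inner_def sum_distrib_right Bochner_Integration.integral_sum l2_inner_integrable)

lemma l2_inner_cnj: "cnj (l2_inner M u v) = l2_inner M v u"
  unfolding l2_inner_def by (subst Bochner_Integration.integral_cnj[symmetric]) (simp add: mult.commute)

lemma l2_inner_diff_right:
  "u \<in> L2 M \<Longrightarrow> v \<in> L2 M \<Longrightarrow> e \<in> L2 M \<Longrightarrow>
    l2_inner M e (\<lambda>x. u x - v x) = l2_inner M e u - l2_inner M e v"
  using arg_cong[OF l2_inner_diff_left, of u M v e cnj] by (simp add: l2_inner_cnj)

lemma l2_inner_scale_right: "l2_inner M e (\<lambda>x. a * u x) = cnj a * l2_inner M e u"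
  using arg_cong[OF l2_inner_scale_left, of cnj M a u e] by (simp add: l2_inner_cnj)

lemma l2_inner_sum_right:
  "(\<And>i. i \<in> A \<Longrightarrow> f i \<in> L2 M) \<Longrightarrow> e \<in> L2 M \<Longrightarrow>
    l2_inner M e (\<lambda>x. \<Sum>i\<in>A. f i x) = (\<Sum>i\<in>A. l2_inner M e (f i))"
  using arg_cong[OF l2_inner_sum_left, of A f M e cnj] by (simp add: l2_inner_cnj)

lemma l2_inner_self: "l2_inner M u u = of_real (l2_sq M u)"
  unfolding l2_inner_def l2_sq_def complex_norm_square[symmetric] by (rule integral_complex_of_real)

lemma l2_sq_nonneg [simp]: "0 \<le> l2_sq M u"
  by (simp add: l2_sq_def)

lemma l2_sq_eq_0_iff: "u \<in> L2 M \<Longrightarrow> l2_sq M u = 0 \<longleftrightarrow> (AE x in M. u x = 0)"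
  by (simp add: l2_sq_def integral_nonneg_eq_0_iff_AE L2_integrable)

lemma l2_sq_diff_commute: "l2_sq M (\<lambda>x. u x - v x) = l2_sq M (\<lambda>x. v x - u x)"
  by (simp add: l2_sq_def norm_minus_commute)

lemma l2_inner_null_right:
  assumes "v \<in> L2 M" "l2_sq M v = 0"
  shows "l2_inner M u v = 0"
proof -
  have "AE x in M. v x = 0"
    using assms by (simp add: l2_sq_eq_0_iff)
  then have "AE x in M. u x * cnj (v x) = 0"
    by eventually_elim simp
  then show ?thesis
    unfolding l2_inner_def by (rule integral_eq_zero_AE)
qed

text \<open>The gain in norm from removing the component along \<open>v\<close> gives both the Cauchy--Schwarz
  inequality and the variational characterization of minimal norm elements below.\<close>

lemma l2_sq_minus_component:
  assumes u: "u \<in> L2 M" and v: "v \<in> L2 M" and nz: "l2_sq M v \<noteq> 0"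
  shows "l2_sq M (\<lambda>x. u x - l2_inner M u v / l2_sq M v * v x)
         = l2_sq M u - (cmod (l2_inner M u v))\<^sup>2 / l2_sq M v"
proof -
  define t where "t = l2_inner M u v / l2_sq M v"
  let ?p = "\<lambda>x. t * v x"
  let ?r = "\<lambda>x. u x - ?p x"
  have p: "?p \<in> L2 M" using v by (rule L2_scale)
  have r: "?r \<in> L2 M" using u p by (rule L2_diff)
  have "l2_inner M ?r v = l2_inner M u v - t * l2_sq M v"
    by (simp add: l2_inner_diff_left u v p l2_inner_scale_left l2_inner_self)
  then have "l2_inner M ?r v = 0"
    using nz by (simp add: t_def)
  then have "l2_inner M ?r ?r = l2_inner M ?r u"
    by (simp add: l2_inner_diff_right r u p l2_inner_scale_right)
  also have "\<dots> = l2_inner M u u - t * cnj (l2_inner M u v)"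
    by (simp add: l2_inner_diff_left u p l2_inner_scale_left l2_inner_cnj)
  also have "\<dots> = of_real (l2_sq M u - (cmod (l2_inner M u v))\<^sup>2 / l2_sq M v)"
    unfolding l2_inner_self t_def of_real_diff of_real_divide complex_norm_square by simp
  finally have "l2_sq M ?r = l2_sq M u - (cmod (l2_inner M u v))\<^sup>2 / l2_sq M v"
    by (simp only: l2_inner_self of_real_eq_iff)
  then show ?thesis by (simp only: t_def)
qed

lemma l2_Cauchy_Schwarz:
  assumes u: "u \<in> L2 M" and v: "v \<in> L2 M"
  shows "(cmod (l2_inner M u v))\<^sup>2 \<le> l2_sq M u * l2_sq M v"
proof (cases "l2_sq M v = 0")
  case True
  then show ?thesis by (simp add: l2_inner_null_right v)
next
  case False
  then have "l2_sq M v > 0" using l2_sq_nonneg[of M v] by linarith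
  moreover have "0 \<le> l2_sq M u - (cmod (l2_inner M u v))\<^sup>2 / l2_sq M v"
    unfolding l2_sq_minus_component[OF u v False, symmetric] by simp
  ultimately show ?thesis by (simp add: pos_divide_le_eq)
qed

lemma l2_inner_tendsto:
  assumes un: "\<And>n. un n \<in> L2 M" and v: "v \<in> L2 M" and e: "e \<in> L2 M"
    and lim: "(\<lambda>n. l2_sq M (\<lambda>x. un n x - v x)) \<longlonglongrightarrow> 0"
  shows "(\<lambda>n. l2_inner M (un n) e) \<longlonglongrightarrow> l2_inner M v e"
proof -
  have "(\<lambda>n. (cmod (l2_inner M (un n) e - l2_inner M v e))\<^sup>2) \<longlonglongrightarrow> 0"
  proof (rule tendsto_sandwich[OF _ _ tendsto_const])
    show "\<forall>\<^sub>F n in sequentially. (cmod (l2_inner M (un n) e - l2_inner M v e))\<^sup>2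
            \<le> l2_sq M (\<lambda>x. un n x - v x) * l2_sq M e"
      using l2_Cauchy_Schwarz[OF L2_diff[OF un v] e] by (simp add: l2_inner_diff_left un v e)
    show "(\<lambda>n. l2_sq M (\<lambda>x. un n x - v x) * l2_sq M e) \<longlonglongrightarrow> 0"
      using tendsto_mult[OF lim tendsto_const] by simp
  qed simp
  from tendsto_real_sqrt[OF this]
  have "(\<lambda>n. cmod (l2_inner M (un n) e - l2_inner M v e)) \<longlonglongrightarrow> 0"
    by simp
  then show ?thesis
    by (simp add: LIM_zero_iff tendsto_norm_zero_iff)
qed

text \<open>If \<open>u\<close> had a component along \<open>v\<close>, removing it would shorten \<open>u\<close>.\<close>

lemma l2_orthogonal_if_minimal:
  assumes u: "u \<in> L2 M" and v: "v \<in> L2 M"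
    and min: "\<And>t. l2_sq M u \<le> l2_sq M (\<lambda>x. u x - t * v x)"
  shows "l2_inner M u v = 0"
proof (cases "l2_sq M v = 0")
  case True
  then show ?thesis by (rule l2_inner_null_right[OF v])
next
  case False
  then have "l2_sq M v > 0" using l2_sq_nonneg[of M v] by linarith
  moreover have "(cmod (l2_inner M u v))\<^sup>2 / l2_sq M v \<le> 0"
    using min[of "l2_inner M u v / l2_sq M v"] l2_sq_minus_component[OF u v False] by simp
  ultimately show ?thesis by (simp add: divide_le_0_iff)
qed

text \<open>The vectors \<open>e l\<close> may be linearly dependent, so the induction is a Gram--Schmidt step that
  allows the new direction \<open>r\<close> to be a null vector; in that case every inner product with \<open>r\<close>
  vanishes and any coefficient works.\<close>

lemma l2_finite_projection:
  assumes "finite A" "\<And>l. l \<in> A \<Longrightarrow> e l \<in> L2 M" "u \<in> L2 M"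
  shows "\<exists>a. \<forall>l\<in>A. l2_inner M (\<lambda>x. u x - (\<Sum>l\<in>A. a l * e l x)) (e l) = 0"
  using assms
proof (induction A arbitrary: u rule: finite_induct)
  case empty
  then show ?case by simp
next
  case (insert k A)
  have e: "e l \<in> L2 M" if "l \<in> insert k A" for l using insert.prems that by blast
  have span: "(\<lambda>x. \<Sum>l\<in>A. a l * e l x) \<in> L2 M" for a
    by (intro L2_sum L2_scale e) simp
  obtain b where b: "\<forall>l\<in>A. l2_inner M (\<lambda>x. e k x - (\<Sum>l\<in>A. b l * e l x)) (e l) = 0"
    using insert.IH[of "e k"] e by auto
  obtain a where a: "\<forall>l\<in>A. l2_inner M (\<lambda>x. u x - (\<Sum>l\<in>A. a l * e l x)) (e l) = 0"
    using insert.IH[of u] e insert.prems(2) by auto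
  define r where "r = (\<lambda>x. e k x - (\<Sum>l\<in>A. b l * e l x))"
  define q where "q = (\<lambda>x. u x - (\<Sum>l\<in>A. a l * e l x))"
  \<comment> \<open>For a null \<open>r\<close> the coefficient is \<open>0\<close>, by division by zero.\<close>
  define t where "t = l2_inner M q r / l2_sq M r"
  have r: "r \<in> L2 M" and q: "q \<in> L2 M"
    using L2_diff[OF e[of k] span] L2_diff[OF insert.prems(2) span] by (auto simp: r_def q_def)
  have tr: "(\<lambda>x. t * r x) \<in> L2 M" using r by (rule L2_scale)
  define s where "s = (\<lambda>x. q x - t * r x)"
  have s: "s \<in> L2 M" unfolding s_def using q tr by (rule L2_diff)
  have sA: "l2_inner M s (e l) = 0" if "l \<in> A" for l
    using a b that e[of l]
    by (simp add: s_def l2_inner_diff_left q tr l2_inner_scale_left flip: q_def r_def)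
  have sr: "l2_inner M s r = 0"
  proof (cases "l2_sq M r = 0")
    case True
    then show ?thesis by (rule l2_inner_null_right[OF r])
  next
    case False
    have "l2_inner M s r = l2_inner M q r - t * l2_sq M r"
      by (simp add: s_def l2_inner_diff_left q r tr l2_inner_scale_left l2_inner_self)
    with False show ?thesis by (simp add: t_def)
  qed
  have "l2_inner M s r = l2_inner M s (e k) - l2_inner M s (\<lambda>x. \<Sum>l\<in>A. b l * e l x)"
    unfolding r_def by (rule l2_inner_diff_right) (auto simp: e span s)
  also have "l2_inner M s (\<lambda>x. \<Sum>l\<in>A. b l * e l x) = 0"
    using e by (subst l2_inner_sum_right) (auto simp: s L2_scale l2_inner_scale_right sA)
  finally have sk: "l2_inner M s (e k) = 0" using sr by simp
  define d where "d = (\<lambda>l. if l = k then t else a l - t * b l)"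
  have "(\<Sum>l\<in>insert k A. d l * e l x) = t * e k x + (\<Sum>l\<in>A. (a l - t * b l) * e l x)" for x
    using insert.hyps by (auto simp: d_def intro!: sum.cong)
  then have "s = (\<lambda>x. u x - (\<Sum>l\<in>insert k A. d l * e l x))"
    by (auto simp: s_def q_def r_def algebra_simps sum_subtractf sum_distrib_left)
  then show ?case using sA sk by (intro exI[of _ d]) auto
qed

section \<open>Completeness\<close>

text \<open>Along a subsequence whose successive differences \<open>d k\<close> have squared norm at most \<open>8\<^sup>-\<^sup>k\<close>,
  the function \<open>\<Sum>k. 2\<^sup>k \<bar>d k\<bar>\<^sup>2\<close> is integrable, hence finite almost everywhere. This forces
  absolute convergence of \<open>\<Sum>k. d k\<close>, because \<open>2 t \<le> 2\<^sup>k t\<^sup>2 + 2\<^sup>-\<^sup>k\<close>. Fatou's lemma then turns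
  the pointwise limit into a limit in norm of the whole sequence.\<close>

lemma L2_complete:
  assumes u: "\<And>n. u n \<in> L2 M"
    and Cauchy: "\<And>\<epsilon>. \<epsilon> > 0 \<Longrightarrow> \<exists>N. \<forall>m\<ge>N. \<forall>n\<ge>N. l2_sq M (\<lambda>x. u m x - u n x) < \<epsilon>"
  shows "\<exists>v\<in>L2 M. (\<lambda>n. l2_sq M (\<lambda>x. u n x - v x)) \<longlonglongrightarrow> 0"
proof -
  have "\<exists>N. \<forall>k. \<forall>m\<ge>N k. \<forall>n\<ge>N k. l2_sq M (\<lambda>x. u m x - u n x) < (1/8)^k"
    using Cauchy by (intro choice allI) simp
  then obtain N where N: "\<And>k m n. m \<ge> N k \<Longrightarrow> n \<ge> N k \<Longrightarrow> l2_sq M (\<lambda>x. u m x - u n x) < (1/8)^k"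
    by blast
  \<comment> \<open>Partial sums dominate all earlier thresholds at once.\<close>
  define r where "r k = (\<Sum>j\<le>k. N j)" for k :: nat
  have r: "r k \<ge> N j" if "j \<le> k" for j k
    unfolding r_def by (rule member_le_sum) (use that in auto)
  have um [measurable]: "u n \<in> borel_measurable M" for n using u by (rule L2_measurable)
  have diff: "(\<lambda>x. u m x - u n x) \<in> L2 M" for m n by (intro L2_diff u)
  define d where "d k x = u (r (Suc k)) x - u (r k) x" for k x
  have dm [measurable]: "d k \<in> borel_measurable M" for k unfolding d_def by measurable
  have nn_sq: "(\<integral>\<^sup>+ x. ennreal ((cmod (f x))\<^sup>2) \<partial>M) = ennreal (l2_sq M f)" if "f \<in> L2 M" for f
    unfolding l2_sq_def by (rule nn_integral_eq_integral) (auto simp: L2_integrable that)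
  have "(\<integral>\<^sup>+ x. (\<Sum>k. ennreal (2^k * (cmod (d k x))\<^sup>2)) \<partial>M)
        = (\<Sum>k. \<integral>\<^sup>+ x. ennreal (2^k * (cmod (d k x))\<^sup>2) \<partial>M)"
    by (rule nn_integral_suminf) measurable
  also have "\<dots> \<le> (\<Sum>k. ennreal ((1/4)^k))"
  proof (rule suminf_le)
    fix k
    have "(\<integral>\<^sup>+ x. ennreal (2^k * (cmod (d k x))\<^sup>2) \<partial>M) = ennreal (2^k) * (\<integral>\<^sup>+ x. ennreal ((cmod (d k x))\<^sup>2) \<partial>M)"
      by (subst nn_integral_cmult[symmetric]) (auto simp: ennreal_mult)
    also have "(\<integral>\<^sup>+ x. ennreal ((cmod (d k x))\<^sup>2) \<partial>M) = ennreal (l2_sq M (d k))"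
      by (rule nn_sq) (use diff in \<open>simp add: d_def[abs_def]\<close>)
    also have "ennreal (2^k) * \<dots> = ennreal (2^k * l2_sq M (d k))"
      by (simp add: ennreal_mult)
    also have "\<dots> \<le> ennreal (2^k * (1/8)^k)"
      using N[OF r r, of k "Suc k" k] by (intro ennreal_leI mult_left_mono) (auto simp: d_def[abs_def])
    also have "2^k * (1/8)^k = ((1/4)^k :: real)"
      by (simp add: power_mult_distrib[symmetric])
    finally show "(\<integral>\<^sup>+ x. ennreal (2^k * (cmod (d k x))\<^sup>2) \<partial>M) \<le> ennreal ((1/4)^k)" .
  qed auto
  also have "\<dots> = ennreal (\<Sum>k. (1/4)^k)"
    by (rule suminf_ennreal2) (auto intro: summable_geometric)
  finally have fin: "(\<integral>\<^sup>+ x. (\<Sum>k. ennreal (2^k * (cmod (d k x))\<^sup>2)) \<partial>M) \<noteq> \<infinity>"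
    by (auto simp: top_unique)
  have "AE x in M. (\<Sum>k. ennreal (2^k * (cmod (d k x))\<^sup>2)) \<noteq> \<infinity>"
    by (rule nn_integral_PInf_AE[OF _ fin]) measurable
  then have conv: "AE x in M. convergent (\<lambda>k. u (r k) x)"
  proof eventually_elim
    case (elim x)
    then have "summable (\<lambda>k. 2^k * (cmod (d k x))\<^sup>2)"
      by (intro summable_suminf_not_top) auto
    then have "summable (\<lambda>k. 2^k * (cmod (d k x))\<^sup>2 + (1/2)^k)"
      by (intro summable_add) (auto intro: summable_geometric)
    then have "summable (\<lambda>k. cmod (d k x))"
    proof (rule summable_comparison_test')
      fix k
      have "0 \<le> (2^k * cmod (d k x) - 1)\<^sup>2 / 2^k" by simp
      also have "\<dots> = 2^k * (cmod (d k x))\<^sup>2 + (1/2)^k - 2 * cmod (d k x)"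
        by (simp add: power2_eq_square field_simps power_divide)
      finally show "norm (cmod (d k x)) \<le> 2^k * (cmod (d k x))\<^sup>2 + (1/2)^k"
        using norm_ge_zero[of "d k x"] unfolding real_norm_def abs_norm_cancel by linarith
    qed
    then have "summable (\<lambda>k. d k x)" by (rule summable_norm_cancel)
    then have "convergent (\<lambda>n. \<Sum>k<n. d k x)" by (simp add: summable_iff_convergent)
    moreover have "(\<Sum>k<n. d k x) = u (r n) x - u (r 0) x" for n
      unfolding d_def by (rule sum_lessThan_telescope)
    ultimately have "convergent (\<lambda>n. u (r n) x - u (r 0) x)" by simp
    then show ?case by (simp add: convergent_diff_const_right_iff)
  qed
  define v where "v x = lim (\<lambda>k. u (r k) x)" for x
  have vm [measurable]: "v \<in> borel_measurable M"
    unfolding v_def[abs_def] by (intro borel_measurable_lim_metric um)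
  have close: "(\<lambda>x. u n x - v x) \<in> L2 M \<and> l2_sq M (\<lambda>x. u n x - v x) \<le> (1/8)^K" if n: "n \<ge> N K" for n K
  proof -
    have "(\<integral>\<^sup>+ x. ennreal ((cmod (u n x - v x))\<^sup>2) \<partial>M)
          = (\<integral>\<^sup>+ x. liminf (\<lambda>k. ennreal ((cmod (u n x - u (r k) x))\<^sup>2)) \<partial>M)"
    proof (rule nn_integral_cong_AE, use conv in eventually_elim)
      case (elim x)
      then have "(\<lambda>k. u (r k) x) \<longlonglongrightarrow> v x"
        by (simp add: v_def convergent_LIMSEQ_iff)
      then have "(\<lambda>k. ennreal ((cmod (u n x - u (r k) x))\<^sup>2)) \<longlonglongrightarrow> ennreal ((cmod (u n x - v x))\<^sup>2)"
        by (intro tendsto_intros tendsto_ennrealI)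
      from lim_imp_Liminf[OF _ this] show ?case by simp
    qed
    also have "\<dots> \<le> liminf (\<lambda>k. \<integral>\<^sup>+ x. ennreal ((cmod (u n x - u (r k) x))\<^sup>2) \<partial>M)"
      by (rule nn_integral_liminf) measurable
    also have "\<dots> \<le> limsup (\<lambda>k. \<integral>\<^sup>+ x. ennreal ((cmod (u n x - u (r k) x))\<^sup>2) \<partial>M)"
      by (rule Liminf_le_Limsup) simp
    also have "\<dots> \<le> ennreal ((1/8)^K)"
    proof (rule Limsup_bounded, rule eventually_mono[OF eventually_ge_at_top[of K]])
      fix k assume "K \<le> k"
      then show "(\<integral>\<^sup>+ x. ennreal ((cmod (u n x - u (r k) x))\<^sup>2) \<partial>M) \<le> ennreal ((1/8)^K)"
        using N[OF n r, of k] by (simp add: nn_sq[OF diff] ennreal_leI)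
    qed
    finally have le: "(\<integral>\<^sup>+ x. ennreal ((cmod (u n x - v x))\<^sup>2) \<partial>M) \<le> ennreal ((1/8)^K)" .
    have "integrable M (\<lambda>x. (cmod (u n x - v x))\<^sup>2)"
    proof (rule integrableI_nonneg)
      show "(\<integral>\<^sup>+ x. ennreal ((cmod (u n x - v x))\<^sup>2) \<partial>M) < \<infinity>"
        using le by (simp add: le_less_trans[OF _ ennreal_less_top])
    qed auto
    then have L2: "(\<lambda>x. u n x - v x) \<in> L2 M" by (simp add: L2_def)
    with le show ?thesis by (simp add: nn_sq)
  qed
  have "(\<lambda>x. u (N 0) x - (u (N 0) x - v x)) \<in> L2 M"
    using close[of 0 "N 0"] by (intro L2_diff[OF u] conjunct1[OF close[of 0]]) simp
  then have "v \<in> L2 M" by simp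
  moreover have "(\<lambda>n. l2_sq M (\<lambda>x. u n x - v x)) \<longlonglongrightarrow> 0"
  proof (rule LIMSEQ_I)
    fix \<epsilon> :: real assume "\<epsilon> > 0"
    then obtain K where "(1/8)^K < \<epsilon>" using real_arch_pow_inv[of \<epsilon> "1/8"] by auto
    then show "\<exists>no. \<forall>n\<ge>no. norm (l2_sq M (\<lambda>x. u n x - v x) - 0) < \<epsilon>"
      using close[of K] by (intro exI[of _ "N K"]) fastforce
  qed
  ultimately show ?thesis by blast
qed

section \<open>Minimal norm interpolation\<close>

lemma l2_Pythagoras:
  assumes u: "u \<in> L2 M" and v: "v \<in> L2 M"
    and orth: "l2_inner M u (\<lambda>x. v x - u x) = 0"
  shows "l2_sq M (\<lambda>x. v x - u x) = l2_sq M v - l2_sq M u"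
proof -
  have uv: "l2_inner M u v = l2_inner M u u"
    using orth by (simp add: l2_inner_diff_right u v)
  have "l2_inner M (\<lambda>x. v x - u x) (\<lambda>x. v x - u x) = l2_inner M v (\<lambda>x. v x - u x)"
    using orth by (simp add: l2_inner_diff_left u v L2_diff)
  also have "\<dots> = l2_inner M v v - cnj (l2_inner M u v)"
    by (simp add: l2_inner_diff_right u v l2_inner_cnj)
  also have "\<dots> = of_real (l2_sq M v - l2_sq M u)"
    unfolding uv l2_inner_self by simp
  finally show ?thesis by (simp only: l2_inner_self of_real_eq_iff)
qed

text \<open>Interpolation conditions are prescribed inner products with the \<open>e l\<close>, and minimality of the
  norm enters as orthogonality to every \<open>v\<close> satisfying the homogeneous conditions. By Pythagoras
  the squared norms of the \<open>un n\<close> increase and are bounded by that of \<open>u\<close>, and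
  \<open>\<parallel>un m - un n\<parallel>\<^sup>2\<close> is the increment of these numbers, so the sequence is Cauchy. Its limit \<open>v\<close>
  satisfies all the conditions. Then \<open>u - v\<close> satisfies the homogeneous ones, so it is orthogonal to
  \<open>u\<close> and to every \<open>un n\<close>, hence to \<open>v\<close> and finally to itself.\<close>

lemma l2_interpolants_converge:
  assumes e: "\<And>l. l \<in> (\<Union>n. A n) \<Longrightarrow> e l \<in> L2 M" and A: "incseq A"
    and un: "\<And>n. un n \<in> L2 M" "\<And>n l. l \<in> A n \<Longrightarrow> l2_inner M (un n) (e l) = c l"
    and un_orth: "\<And>n v. v \<in> L2 M \<Longrightarrow> (\<And>l. l \<in> A n \<Longrightarrow> l2_inner M v (e l) = 0) \<Longrightarrow> l2_inner M (un n) v = 0"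
    and u: "u \<in> L2 M" "\<And>l. l \<in> (\<Union>n. A n) \<Longrightarrow> l2_inner M u (e l) = c l"
    and u_orth: "\<And>v. v \<in> L2 M \<Longrightarrow> (\<And>l. l \<in> (\<Union>n. A n) \<Longrightarrow> l2_inner M v (e l) = 0) \<Longrightarrow> l2_inner M u v = 0"
  shows "(\<lambda>n. l2_sq M (\<lambda>x. u x - un n x)) \<longlonglongrightarrow> 0"
proof -
  have e': "e l \<in> L2 M" if "l \<in> A n" for l n using e that by blast
  have u': "l2_inner M u (e l) = c l" if "l \<in> A n" for l n using u(2) that by blast
  have A': "l \<in> A m" if "l \<in> A n" "n \<le> m" for l m n using A that by (meson incseqD subsetD)
  have step: "l2_sq M (\<lambda>x. un m x - un n x) = l2_sq M (un m) - l2_sq M (un n)" if "n \<le> m" for m n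
  proof (rule l2_Pythagoras)
    show "l2_inner M (un n) (\<lambda>x. un m x - un n x) = 0"
      using that by (intro un_orth L2_diff un) (simp add: l2_inner_diff_left un e' A')
  qed (rule un)+
  have bound: "l2_sq M (un n) \<le> l2_sq M u" for n
  proof -
    have "l2_inner M (un n) (\<lambda>x. u x - un n x) = 0"
      by (intro un_orth L2_diff un u) (simp add: l2_inner_diff_left un u(1) u' e')
    from l2_Pythagoras[OF un(1) u(1) this] show ?thesis
      using l2_sq_nonneg[of M "\<lambda>x. u x - un n x"] by linarith
  qed
  have "incseq (\<lambda>n. l2_sq M (un n))"
    unfolding incseq_def using step l2_sq_nonneg by (metis diff_ge_0_iff_ge)
  then obtain L where "(\<lambda>n. l2_sq M (un n)) \<longlonglongrightarrow> L"
    by (rule incseq_convergent) (use bound in auto)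
  then have Cauchy: "Cauchy (\<lambda>n. l2_sq M (un n))" by (rule LIMSEQ_imp_Cauchy)
  have "\<exists>N. \<forall>m\<ge>N. \<forall>n\<ge>N. l2_sq M (\<lambda>x. un m x - un n x) < \<epsilon>" if "\<epsilon> > 0" for \<epsilon>
  proof -
    obtain N where N: "\<forall>m\<ge>N. \<forall>n\<ge>N. norm (l2_sq M (un m) - l2_sq M (un n)) < \<epsilon>"
      using CauchyD[OF Cauchy \<open>\<epsilon> > 0\<close>] by blast
    have "l2_sq M (\<lambda>x. un m x - un n x) < \<epsilon>" if "m \<ge> N" "n \<ge> N" for m n
    proof (cases "n \<le> m")
      case True
      then show ?thesis using N that step[of n m] by fastforce
    next
      case False
      then show ?thesis
        using N that step[of m n] l2_sq_diff_commute[of M "un m" "un n"] by fastforce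
    qed
    then show ?thesis by blast
  qed
  from L2_complete[OF un(1) this] obtain v where
    v: "v \<in> L2 M" and lim: "(\<lambda>n. l2_sq M (\<lambda>x. un n x - v x)) \<longlonglongrightarrow> 0" by blast
  have ve: "l2_inner M v (e l) = c l" if l: "l \<in> (\<Union>n. A n)" for l
  proof (rule LIMSEQ_unique)
    show "(\<lambda>n. l2_inner M (un n) (e l)) \<longlonglongrightarrow> l2_inner M v (e l)"
      by (rule l2_inner_tendsto[OF un(1) v e[OF l] lim])
    obtain k where "l \<in> A k" using l by blast
    then show "(\<lambda>n. l2_inner M (un n) (e l)) \<longlonglongrightarrow> c l"
      by (intro tendsto_eventually eventually_mono[OF eventually_ge_at_top[of k]]) (simp add: un A')
  qed
  define k where "k = (\<lambda>x. u x - v x)"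
  have k: "k \<in> L2 M" unfolding k_def by (intro L2_diff u v)
  have ke: "l2_inner M k (e l) = 0" if "l \<in> (\<Union>n. A n)" for l
    unfolding k_def using that by (simp only: l2_inner_diff_left u v e ve)  simp
  have uk: "l2_inner M u k = 0" using k ke by (rule u_orth)
  have "l2_inner M (un n) k = 0" for n using k by (rule un_orth) (auto intro: ke)
  then have vk: "l2_inner M v k = 0"
    using l2_inner_tendsto[OF un(1) v k lim] by (simp add: LIMSEQ_const_iff)
  have "l2_inner M k k = 0"
    using uk vk by (subst k_def) (simp add: l2_inner_diff_left u v k)
  then have "AE x in M. k x = 0"
    using k by (simp add: l2_inner_self l2_sq_eq_0_iff)
  then have ae: "AE x in M. u x = v x" unfolding k_def by eventually_elim simp
  have "l2_sq M (\<lambda>x. u x - un n x) = l2_sq M (\<lambda>x. un n x - v x)" for n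
    unfolding l2_sq_def
  proof (rule integral_cong_AE)
    show "AE x in M. (cmod (u x - un n x))\<^sup>2 = (cmod (un n x - v x))\<^sup>2"
      using ae by eventually_elim (simp add: norm_minus_commute)
  qed (use L2_diff[OF u(1) un(1), of n] L2_diff[OF un(1) v, of n] L2_integrable in blast)+
  then show ?thesis using lim by simp
qed

section \<open>Weights and characters\<close>

text \<open>If \<open>w \<gamma> < 1\<close>, submultiplicativity gives \<open>ln (w (n\<gamma>)) \<le> n ln (w \<gamma>)\<close>, and the
  Beurling--Domar series would be bounded above by a negative multiple of the harmonic series.\<close>

lemma beurling_domar_weight_ge_1:
  assumes w: "submultiplicative_weight w" and bd: "beurling_domar w"
  shows "1 \<le> w \<gamma>"
proof (rule ccontr)
  assume "\<not> 1 \<le> w \<gamma>"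
  moreover have pos: "0 < w \<delta>" and sub: "w (\<delta> + \<epsilon>) \<le> w \<delta> * w \<epsilon>" for \<delta> \<epsilon>
    using w by (auto simp: submultiplicative_weight_def)
  ultimately have neg: "ln (w \<gamma>) < 0" by (simp add: ln_less_zero)
  have pow: "w (\<Sum>_<Suc n. \<gamma>) \<le> w \<gamma> ^ Suc n" for n
  proof (induction n)
    case (Suc n)
    have "w (\<Sum>_<Suc (Suc n). \<gamma>) \<le> w (\<Sum>_<Suc n. \<gamma>) * w \<gamma>"
      unfolding sum.lessThan_Suc[of _ "Suc n"] by (rule sub)
    also have "\<dots> \<le> w \<gamma> ^ Suc n * w \<gamma>"
      using Suc.IH pos[of \<gamma>] by (intro mult_right_mono) auto
    finally show ?case by (simp add: mult_ac)
  qed simp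
  have le: "ln (w (\<Sum>_<Suc n. \<gamma>)) / (real (Suc n))\<^sup>2 \<le> ln (w \<gamma>) * inverse (real (Suc n))" for n
  proof -
    have "ln (w (\<Sum>_<Suc n. \<gamma>)) \<le> ln (w \<gamma> ^ Suc n)"
      using pow pos by (subst ln_le_cancel_iff) auto
    also have "\<dots> = real (Suc n) * ln (w \<gamma>)"
      using pos by (subst ln_realpow) auto
    finally have "ln (w (\<Sum>_<Suc n. \<gamma>)) / (real (Suc n))\<^sup>2 \<le> real (Suc n) * ln (w \<gamma>) / (real (Suc n))\<^sup>2"
      by (intro divide_right_mono) auto
    also have "\<dots> = ln (w \<gamma>) * inverse (real (Suc n))"
      by (simp add: power2_eq_square divide_inverse del: of_nat_Suc)
    finally show ?thesis .
  qed
  have "summable (\<lambda>n. - (ln (w (\<Sum>_<Suc n. \<gamma>)) / (real (Suc n))\<^sup>2))"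
    using bd unfolding beurling_domar_def by (intro summable_minus) blast
  then have "summable (\<lambda>n. (- ln (w \<gamma>)) * inverse (real (Suc n)))"
  proof (rule summable_comparison_test')
    fix n
    show "norm ((- ln (w \<gamma>)) * inverse (real (Suc n))) \<le> - (ln (w (\<Sum>_<Suc n. \<gamma>)) / (real (Suc n))\<^sup>2)"
      using le[of n] neg by (simp add: abs_mult del: of_nat_Suc)
  qed
  then have "summable (\<lambda>n. inverse (real (Suc n)))"
    using neg by (subst (asm) summable_cmult_iff) auto
  then have "summable (\<lambda>n. inverse (real n))" by (subst (asm) summable_Suc_iff)
  then show False using not_summable_harmonic[where 'a=real] by blast
qed

text \<open>Points are compact, so evaluation at a point is continuous for the compact-open topology.\<close>

lemma continuous_on_char_at_dual:
  "continuous_on UNIV (\<lambda>\<gamma> :: 'g::topological_ab_group_add dual. char_at \<gamma> x)"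
  unfolding continuous_on_open_vimage[OF open_UNIV]
proof (intro allI impI)
  fix U :: "complex set" assume U: "open U"
  have "(\<lambda>\<gamma> :: 'g dual. char_at \<gamma> x) -` U \<inter> UNIV = {\<gamma>. char_at \<gamma> ` {x} \<subseteq> U}" by auto
  also have "open \<dots>"
    unfolding open_dual_def
    by (intro generate_topology.Basis CollectI exI[of _ "{x}"] exI[of _ U] conjI U refl) simp
  finally show "open ((\<lambda>\<gamma> :: 'g dual. char_at \<gamma> x) -` U \<inter> UNIV)" .
qed

lemma char_at_diff: "char_at \<gamma> (x - y) = char_at \<gamma> x * cnj (char_at \<gamma> y)"
proof -
  have "char_at \<gamma> (x - y) * (char_at \<gamma> y * cnj (char_at \<gamma> y)) = char_at \<gamma> x * cnj (char_at \<gamma> y)"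
    using char_at_add[of \<gamma> "x - y" y] by (simp flip: mult.assoc)
  moreover have "char_at \<gamma> y * cnj (char_at \<gamma> y) = 1"
    using complex_norm_square[of "char_at \<gamma> y"] by simp
  ultimately show ?thesis by simp
qed

section \<open>The harmonic Hilbert space as an isometric image of L2\<close>

locale harmonic_setting =
  fixes \<mu> :: "('g::topological_ab_group_add) measure" and \<nu> :: "'g dual measure"
    and w :: "'g dual \<Rightarrow> real"
  assumes sets_dual: "sets \<nu> = sets borel"
    and weight_ge_1: "\<And>\<gamma>. 1 \<le> w \<gamma>"
    and inverse_weight_L2: "(\<lambda>\<gamma>. of_real (inverse (w \<gamma>))) \<in> L2 \<nu>"
    and Plancherel: "\<And>h. h \<in> L1 \<nu> \<Longrightarrow> h \<in> L2 \<nu> \<Longrightarrow>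
      (\<integral>x. (cmod (inv_fourier \<nu> h x))\<^sup>2 \<partial>\<mu>) = (\<integral>\<gamma>. (cmod (h \<gamma>))\<^sup>2 \<partial>\<nu>)"
begin

text \<open>The unitary map from \<open>L\<^sup>2\<close> onto the harmonic space: the Fourier transform of \<open>synth u\<close> is
  \<open>u / w\<close>.\<close>

definition synth :: "('g dual \<Rightarrow> complex) \<Rightarrow> 'g \<Rightarrow> complex" where
  "synth u = inv_fourier \<nu> (\<lambda>\<gamma>. u \<gamma> * of_real (inverse (w \<gamma>)))"

text \<open>The preimage under \<open>synth\<close> of the reproducing kernel at \<open>x\<close>.\<close>

definition kern :: "'g \<Rightarrow> 'g dual \<Rightarrow> complex" where
  "kern x \<gamma> = cnj (char_at \<gamma> x) * of_real (inverse (w \<gamma>))"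

lemma weight_nonzero: "w \<gamma> \<noteq> 0"
  using weight_ge_1[of \<gamma>] by auto

lemma borel_measurable_dual: "continuous_on UNIV f \<Longrightarrow> f \<in> borel_measurable \<nu>"
  using borel_measurable_continuous_onI measurable_cong_sets[OF sets_dual refl] by blast

lemma norm_kern: "cmod (kern x \<gamma>) = cmod (of_real (inverse (w \<gamma>)))"
  by (simp add: kern_def norm_mult)

lemma kern_L2: "kern x \<in> L2 \<nu>"
proof -
  have "kern x \<in> borel_measurable \<nu>"
    unfolding kern_def[abs_def]
    by (intro borel_measurable_times borel_measurable_dual continuous_on_cnj
        continuous_on_char_at_dual L2_measurable[OF inverse_weight_L2])
  then show ?thesis
    using inverse_weight_L2 by (simp add: L2_def norm_kern)
qed

lemma l2_sq_kern: "l2_sq \<nu> (kern x) = l2_sq \<nu> (\<lambda>\<gamma>. of_real (inverse (w \<gamma>)))"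
  by (simp only: l2_sq_def norm_kern)

lemma synth_eq_inner: "synth u x = l2_inner \<nu> u (kern x)"
  by (simp add: synth_def inv_fourier_def l2_inner_def kern_def mult_ac)

lemma harmonic_space_eq: "harmonic_space \<nu> w = synth ` L2 \<nu>"
proof (intro equalityI subsetI)
  fix f assume "f \<in> harmonic_space \<nu> w"
  then obtain h where h: "(\<lambda>\<gamma>. h \<gamma> * of_real (w \<gamma>)) \<in> L2 \<nu>" and f: "f = inv_fourier \<nu> h"
    by (auto simp: harmonic_space_def weighted_L2_def)
  have "f = synth (\<lambda>\<gamma>. h \<gamma> * of_real (w \<gamma>))"
    by (simp add: synth_def f weight_nonzero mult.assoc)
  then show "f \<in> synth ` L2 \<nu>" using h by blast
next
  fix f assume "f \<in> synth ` L2 \<nu>"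
  then obtain u where u: "u \<in> L2 \<nu>" and f: "f = synth u" by blast
  have "(\<lambda>\<gamma>. u \<gamma> * of_real (inverse (w \<gamma>)) * of_real (w \<gamma>)) = u"
    by (simp add: weight_nonzero mult.assoc)
  moreover have "(\<lambda>\<gamma>. u \<gamma> * of_real (inverse (w \<gamma>))) \<in> borel_measurable \<nu>"
    by (intro borel_measurable_times L2_measurable u inverse_weight_L2)
  ultimately have "(\<lambda>\<gamma>. u \<gamma> * of_real (inverse (w \<gamma>))) \<in> weighted_L2 \<nu> w"
    using u by (simp only: weighted_L2_def mem_Collect_eq simp_thms)
  then show "f \<in> harmonic_space \<nu> w" by (simp add: harmonic_space_def f synth_def)
qed

lemma synth_diff:
  "u \<in> L2 \<nu> \<Longrightarrow> v \<in> L2 \<nu> \<Longrightarrow> synth (\<lambda>\<gamma>. u \<gamma> - v \<gamma>) = (\<lambda>x. synth u x - synth v x)"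
  by (simp add: synth_eq_inner fun_eq_iff l2_inner_diff_left kern_L2)

text \<open>The only place where Plancherel's theorem enters. The function \<open>(u - v) / w\<close> is integrable as
  a product of square-integrable functions and, since \<open>w \<ge> 1\<close>, itself square-integrable; its
  inverse Fourier transform is zero, so it vanishes almost everywhere.\<close>

lemma synth_inj:
  assumes u: "u \<in> L2 \<nu>" and v: "v \<in> L2 \<nu>" and eq: "synth u = synth v"
  shows "AE \<gamma> in \<nu>. u \<gamma> = v \<gamma>"
proof -
  define h where "h \<gamma> = (u \<gamma> - v \<gamma>) * of_real (inverse (w \<gamma>))" for \<gamma>
  have d: "(\<lambda>\<gamma>. u \<gamma> - v \<gamma>) \<in> L2 \<nu>" using u v by (rule L2_diff)
  have hi: "integrable \<nu> h"
    unfolding h_def[abs_def] using d inverse_weight_L2 by (rule L2_integrable_mult)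
  have "integrable \<nu> (\<lambda>\<gamma>. (cmod (h \<gamma>))\<^sup>2)"
  proof (rule Bochner_Integration.integrable_bound[OF L2_integrable[OF d]])
    show "(\<lambda>\<gamma>. (cmod (h \<gamma>))\<^sup>2) \<in> borel_measurable \<nu>"
      using borel_measurable_integrable[OF hi] by simp
    have "cmod (h \<gamma>) \<le> cmod (u \<gamma> - v \<gamma>)" for \<gamma>
    proof -
      have "inverse \<bar>w \<gamma>\<bar> \<le> 1"
        using weight_ge_1[of \<gamma>] by (auto simp: inverse_le_1_iff)
      then show ?thesis
        using mult_left_mono[of "inverse \<bar>w \<gamma>\<bar>" 1 "cmod (u \<gamma> - v \<gamma>)"]
        by (simp add: h_def norm_mult norm_inverse)
    qed
    then show "AE \<gamma> in \<nu>. norm ((cmod (h \<gamma>))\<^sup>2) \<le> norm ((cmod (u \<gamma> - v \<gamma>))\<^sup>2)"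
      by (simp add: power_mono)
  qed
  then have h: "h \<in> L2 \<nu>" using hi by (simp add: L2_def)
  have "inv_fourier \<nu> h = (\<lambda>_. 0)"
    using synth_diff[OF u v] eq by (simp add: synth_def h_def[abs_def])
  then have "l2_sq \<nu> h = 0"
    using Plancherel[of h] hi h by (simp add: L1_def l2_sq_def)
  then have "AE \<gamma> in \<nu>. h \<gamma> = 0" using h by (simp add: l2_sq_eq_0_iff)
  then show ?thesis by eventually_elim (simp add: h_def weight_nonzero)
qed

text \<open>The transform of an element of the harmonic space is chosen arbitrarily among all admissible
  functions; injectivity shows that the choice matters only on a null set.\<close>

lemma harmonic_hat_synth:
  assumes u: "u \<in> L2 \<nu>"
  defines "h \<equiv> harmonic_hat \<nu> w (synth u)"
  shows "(\<lambda>\<gamma>. h \<gamma> * of_real (w \<gamma>)) \<in> L2 \<nu>" "AE \<gamma> in \<nu>. h \<gamma> * of_real (w \<gamma>) = u \<gamma>"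
proof -
  have "synth u \<in> harmonic_space \<nu> w" using u by (simp add: harmonic_space_eq)
  then have "\<exists>h. h \<in> weighted_L2 \<nu> w \<and> inv_fourier \<nu> h = synth u"
    unfolding harmonic_space_def by auto
  from someI_ex[OF this] have "h \<in> weighted_L2 \<nu> w" and eq: "inv_fourier \<nu> h = synth u"
    unfolding h_def harmonic_hat_def by auto
  then show L2: "(\<lambda>\<gamma>. h \<gamma> * of_real (w \<gamma>)) \<in> L2 \<nu>" by (simp add: weighted_L2_def)
  have "synth (\<lambda>\<gamma>. h \<gamma> * of_real (w \<gamma>)) = synth u"
    unfolding eq[symmetric] by (simp add: synth_def weight_nonzero mult.assoc)
  then show "AE \<gamma> in \<nu>. h \<gamma> * of_real (w \<gamma>) = u \<gamma>" by (rule synth_inj[OF L2 u])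
qed

lemma harmonic_inner_synth:
  assumes u: "u \<in> L2 \<nu>" and v: "v \<in> L2 \<nu>"
  shows "harmonic_inner \<nu> w (synth u) (synth v) = l2_inner \<nu> u v"
proof -
  let ?h = "harmonic_hat \<nu> w (synth u)" and ?k = "harmonic_hat \<nu> w (synth v)"
  note hu = harmonic_hat_synth[OF u] and hv = harmonic_hat_synth[OF v]
  have "harmonic_inner \<nu> w (synth u) (synth v)
    = l2_inner \<nu> (\<lambda>\<gamma>. ?h \<gamma> * of_real (w \<gamma>)) (\<lambda>\<gamma>. ?k \<gamma> * of_real (w \<gamma>))"
    by (simp add: harmonic_inner_def l2_inner_def power2_eq_square mult_ac)
  also have "\<dots> = l2_inner \<nu> u v"
    unfolding l2_inner_def
  proof (rule integral_cong_AE)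
    show "AE \<gamma> in \<nu>. ?h \<gamma> * of_real (w \<gamma>) * cnj (?k \<gamma> * of_real (w \<gamma>)) = u \<gamma> * cnj (v \<gamma>)"
      using hu(2) hv(2) by eventually_elim simp
  qed (intro borel_measurable_integrable l2_inner_integrable hu(1) hv(1) u v)+
  finally show ?thesis .
qed

lemma harmonic_norm_synth: "u \<in> L2 \<nu> \<Longrightarrow> harmonic_norm \<nu> w (synth u) = sqrt (l2_sq \<nu> u)"
  by (simp add: harmonic_norm_def harmonic_inner_synth l2_inner_self)

lemma translate_eq_synth_kern:
  "translate l (inv_fourier \<nu> (\<lambda>\<gamma>. of_real (inverse ((w \<gamma>)\<^sup>2)))) = synth (kern l)"
  by (simp add: translate_def synth_def inv_fourier_def kern_def fun_eq_iff char_at_diff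
      power2_eq_square mult_ac)

lemma synth_sum_kern: "synth (\<lambda>\<gamma>. \<Sum>l\<in>A. a l * kern l \<gamma>) = (\<lambda>x. \<Sum>l\<in>A. a l * synth (kern l) x)"
  by (simp add: fun_eq_iff synth_eq_inner l2_inner_sum_left L2_scale kern_L2 l2_inner_scale_left)

lemma kern_sum_L2: "(\<lambda>\<gamma>. \<Sum>l\<in>A. a l * kern l \<gamma>) \<in> L2 \<nu>"
  by (intro L2_sum L2_scale kern_L2)

text \<open>The kernels all have the same norm, so convergence in the harmonic norm is uniform.\<close>

lemma norm_synth_le:
  assumes "u \<in> L2 \<nu>"
  shows "(cmod (synth u x))\<^sup>2 \<le> l2_sq \<nu> u * l2_sq \<nu> (\<lambda>\<gamma>. of_real (inverse (w \<gamma>)))"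
  using l2_Cauchy_Schwarz[OF assms kern_L2, of x] by (simp only: synth_eq_inner l2_sq_kern)

lemma min_norm_interpolantD:
  assumes "min_norm_interpolant \<nu> w A c g"
  obtains u where "u \<in> L2 \<nu>" "g = synth u" "\<And>l. l \<in> A \<Longrightarrow> l2_inner \<nu> u (kern l) = c l"
    "\<And>v. v \<in> L2 \<nu> \<Longrightarrow> (\<And>l. l \<in> A \<Longrightarrow> l2_inner \<nu> v (kern l) = 0) \<Longrightarrow> l2_inner \<nu> u v = 0"
proof -
  have g: "g \<in> harmonic_space \<nu> w" "\<And>l. l \<in> A \<Longrightarrow> g l = c l"
    and min: "\<And>f. f \<in> harmonic_space \<nu> w \<Longrightarrow> (\<And>l. l \<in> A \<Longrightarrow> f l = c l) \<Longrightarrow>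
        harmonic_norm \<nu> w g \<le> harmonic_norm \<nu> w f"
    using assms by (auto simp: min_norm_interpolant_def is_arg_min_def not_less)
  obtain u where u: "u \<in> L2 \<nu>" and gu: "g = synth u"
    using g(1) by (auto simp: harmonic_space_eq)
  have interp: "l2_inner \<nu> u (kern l) = c l" if "l \<in> A" for l
    using g(2)[OF that] by (simp add: gu synth_eq_inner)
  have "l2_inner \<nu> u v = 0"
    if v: "v \<in> L2 \<nu>" and vk: "\<And>l. l \<in> A \<Longrightarrow> l2_inner \<nu> v (kern l) = 0" for v
  proof (rule l2_orthogonal_if_minimal[OF u v])
    fix t
    let ?u = "\<lambda>\<gamma>. u \<gamma> - t * v \<gamma>"
    have tv: "(\<lambda>\<gamma>. t * v \<gamma>) \<in> L2 \<nu>" using v by (rule L2_scale)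
    have ut: "?u \<in> L2 \<nu>" using u tv by (rule L2_diff)
    have "harmonic_norm \<nu> w g \<le> harmonic_norm \<nu> w (synth ?u)"
    proof (rule min)
      show "synth ?u \<in> harmonic_space \<nu> w" using ut by (simp add: harmonic_space_eq)
      show "synth ?u l = c l" if "l \<in> A" for l
        using that by (simp add: synth_eq_inner l2_inner_diff_left u tv kern_L2
            l2_inner_scale_left vk interp)
    qed
    then show "l2_sq \<nu> u \<le> l2_sq \<nu> ?u" by (simp add: gu harmonic_norm_synth u ut)
  qed
  with u gu interp show thesis by (rule that)
qed

text \<open>Let \<open>p\<close> be the projection of \<open>u\<close> onto the span of the kernels at the points of \<open>A\<close>. The
  remainder \<open>q = u - p\<close> is orthogonal to these kernels; so it is orthogonal to \<open>p\<close>, and by hypothesis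
  to \<open>u\<close>. Hence \<open>q\<close> is orthogonal to itself.\<close>

lemma min_norm_interpolant_in_span:
  assumes fin: "finite A" and u: "u \<in> L2 \<nu>"
    and orth: "\<And>v. v \<in> L2 \<nu> \<Longrightarrow> (\<And>l. l \<in> A \<Longrightarrow> l2_inner \<nu> v (kern l) = 0) \<Longrightarrow> l2_inner \<nu> u v = 0"
  obtains a where "synth u = (\<lambda>x. \<Sum>l\<in>A. a l * synth (kern l) x)"
proof -
  obtain a where a: "\<forall>l\<in>A. l2_inner \<nu> (\<lambda>x. u x - (\<Sum>l\<in>A. a l * kern l x)) (kern l) = 0"
    using l2_finite_projection[where e = kern, OF fin kern_L2 u] by blast
  define p where "p = (\<lambda>\<gamma>. \<Sum>l\<in>A. a l * kern l \<gamma>)"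
  have p: "p \<in> L2 \<nu>" unfolding p_def by (rule kern_sum_L2)
  define q where "q = (\<lambda>\<gamma>. u \<gamma> - p \<gamma>)"
  have q: "q \<in> L2 \<nu>" unfolding q_def using u p by (rule L2_diff)
  have qk: "l2_inner \<nu> q (kern l) = 0" if "l \<in> A" for l
    using a that by (simp add: q_def p_def)
  have "l2_inner \<nu> p q = cnj (l2_inner \<nu> q p)" by (simp add: l2_inner_cnj)
  also have "l2_inner \<nu> q p = 0"
    unfolding p_def by (subst l2_inner_sum_right) (auto simp: L2_scale kern_L2 q l2_inner_scale_right qk)
  finally have "l2_inner \<nu> p q = 0" by simp
  moreover have "l2_inner \<nu> u q = 0" using q qk by (rule orth)
  ultimately have "l2_inner \<nu> q q = 0"
    by (subst q_def) (simp add: l2_inner_diff_left u p q)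
  then have "l2_sq \<nu> q = 0" by (simp add: l2_inner_self)
  then have "(cmod (synth q x))\<^sup>2 \<le> 0" for x
    using norm_synth_le[OF q, of x] by simp
  then have "synth u x = synth p x" for x
    using synth_diff[OF u p] by (simp add: q_def fun_eq_iff)
  then have "synth u = (\<lambda>x. \<Sum>l\<in>A. a l * synth (kern l) x)"
    unfolding synth_sum_kern[symmetric] p_def by blast
  then show thesis by (rule that)
qed

text \<open>Values at the points of \<open>A\<close> are inner products with the kernels that span the subspace, so
  agreement on \<open>A\<close> says exactly that the difference is orthogonal to the subspace.\<close>

lemma harmonic_proj_eqI:
  assumes u: "u \<in> L2 \<nu>"
    and \<phi>: "\<phi> = inv_fourier \<nu> (\<lambda>\<gamma>. of_real (inverse ((w \<gamma>)\<^sup>2)))"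
    and span: "p \<in> translate_span A \<phi>"
    and agree: "\<And>l. l \<in> A \<Longrightarrow> synth u l = p l"
  shows "harmonic_proj \<nu> w (translate_span A \<phi>) (synth u) = p"
proof -
  define comb where "comb a = (\<lambda>\<gamma>. \<Sum>l\<in>A. a l * kern l \<gamma>)" for a
  have comb: "comb a \<in> L2 \<nu>" for a unfolding comb_def by (rule kern_sum_L2)
  have V: "translate_span A \<phi> = range (\<lambda>a. synth (comb a))"
    unfolding translate_span_def \<phi> translate_eq_synth_kern comb_def synth_sum_kern ..
  have ortho: "(\<forall>v\<in>translate_span A \<phi>. harmonic_inner \<nu> w (\<lambda>x. synth u x - synth (comb b) x) v = 0)
      \<longleftrightarrow> (\<forall>a. l2_inner \<nu> (\<lambda>\<gamma>. u \<gamma> - comb b \<gamma>) (comb a) = 0)" for b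
    unfolding V by (simp add: synth_diff[OF u comb, symmetric] harmonic_inner_synth L2_diff u comb)
  obtain b where b: "p = synth (comb b)" using span unfolding V by blast
  have diff: "(\<lambda>\<gamma>. u \<gamma> - comb b \<gamma>) \<in> L2 \<nu>" using u comb by (rule L2_diff)
  have "l2_inner \<nu> (\<lambda>\<gamma>. u \<gamma> - comb b \<gamma>) (kern l) = 0" if "l \<in> A" for l
    using agree[OF that]
    by (simp only: l2_inner_diff_left u comb kern_L2 b synth_eq_inner right_minus_eq)
  then have orth_b: "l2_inner \<nu> (\<lambda>\<gamma>. u \<gamma> - comb b \<gamma>) (comb a) = 0" for a
    using diff
    by (subst comb_def, subst l2_inner_sum_right) (auto simp: L2_scale kern_L2 l2_inner_scale_right)
  show ?thesis
    unfolding harmonic_proj_def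
  proof (rule the_equality, intro conjI span)
    show "\<forall>v\<in>translate_span A \<phi>. harmonic_inner \<nu> w (\<lambda>x. synth u x - p x) v = 0"
      using orth_b ortho b by blast
  next
    fix f assume f: "f \<in> translate_span A \<phi> \<and>
      (\<forall>v\<in>translate_span A \<phi>. harmonic_inner \<nu> w (\<lambda>x. synth u x - f x) v = 0)"
    then obtain a where a: "f = synth (comb a)" unfolding V by blast
    define d where "d = comb (\<lambda>l. b l - a l)"
    have d_eq: "d = (\<lambda>\<gamma>. comb b \<gamma> - comb a \<gamma>)"
      by (simp add: d_def comb_def left_diff_distrib sum_subtractf)
    have d: "d \<in> L2 \<nu>" unfolding d_def by (rule comb)
    have "l2_inner \<nu> (\<lambda>\<gamma>. u \<gamma> - comb a \<gamma>) d = 0"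
      using f ortho[of a] unfolding a d_def by blast
    moreover have "l2_inner \<nu> (\<lambda>\<gamma>. u \<gamma> - comb b \<gamma>) d = 0" unfolding d_def by (rule orth_b)
    ultimately have "l2_inner \<nu> d d = 0"
      by (subst (1) d_eq) (simp add: l2_inner_diff_left u comb d)
    then have "(cmod (synth d x))\<^sup>2 \<le> 0" for x
      using norm_synth_le[OF d, of x] by (simp add: l2_inner_self)
    then show "f = p"
      using synth_diff[OF comb[of b] comb[of a]] by (simp add: a b fun_eq_iff flip: d_eq)
  qed
qed

end

section \<open>Convergence of the finite interpolants\<close>

theorem mainTheorem4:
  fixes \<mu> :: "('g::{topological_ab_group_add,t2_space}) measure"
    and \<nu> :: "'g dual measure"
    and w :: "'g dual \<Rightarrow> real"
    and \<phi> :: "'g \<Rightarrow> complex"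
    and \<Lambda> :: "'g set"
    and \<Lambda>s :: "nat \<Rightarrow> 'g set"
    and c :: "'g \<Rightarrow> complex"
    and g :: "'g \<Rightarrow> complex"
    and gs :: "nat \<Rightarrow> 'g \<Rightarrow> complex"
  assumes "locally_compact_space (euclidean :: 'g topology)"
    and "haar_measure \<mu>" and "haar_measure \<nu>" and "fourier_normalized \<mu> \<nu>"
    and "submultiplicative_weight w" and "beurling_domar w"
    and "(\<lambda>\<gamma>. of_real (inverse (w \<gamma>))) \<in> L2 \<nu>"
    and "\<phi> = inv_fourier \<nu> (\<lambda>\<gamma>. of_real (inverse ((w \<gamma>)\<^sup>2)))"
    and "lattice_in \<Lambda>" and "countable \<Lambda>" and "countable (annihilator \<Lambda>)"
    and "\<And>n. finite (\<Lambda>s n)" and "\<And>n. \<Lambda>s n \<subseteq> \<Lambda>s (Suc n)" and "(\<Union>n. \<Lambda>s n) = \<Lambda>"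
    and "(\<lambda>l. (cmod (c l))\<^sup>2) summable_on \<Lambda>"
    and "min_norm_interpolant \<nu> w \<Lambda> c g"
    and "\<And>n. min_norm_interpolant \<nu> w (\<Lambda>s n) c (gs n)"
  shows "(\<forall>n. gs n = harmonic_proj \<nu> w (translate_span (\<Lambda>s n) \<phi>) g) \<and>
         (\<lambda>n. harmonic_norm \<nu> w (\<lambda>x. g x - gs n x)) \<longlonglongrightarrow> 0 \<and>
         uniform_limit UNIV gs g sequentially"
proof -
  interpret harmonic_setting \<mu> \<nu> w
  proof
    show "sets \<nu> = sets borel" using assms(3) by (simp add: haar_measure_def)
    show "1 \<le> w \<gamma>" for \<gamma> using assms(5,6) by (rule beurling_domar_weight_ge_1)
    show "(\<lambda>\<gamma>. of_real (inverse (w \<gamma>))) \<in> L2 \<nu>" by (rule assms(7))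
    show "(\<integral>x. (cmod (inv_fourier \<nu> h x))\<^sup>2 \<partial>\<mu>) = (\<integral>\<gamma>. (cmod (h \<gamma>))\<^sup>2 \<partial>\<nu>)"
      if "h \<in> L1 \<nu>" "h \<in> L2 \<nu>" for h
      using assms(4) that unfolding fourier_normalized_def by blast
  qed
  obtain u where u: "u \<in> L2 \<nu>" and g: "g = synth u"
    and uc: "\<And>l. l \<in> \<Lambda> \<Longrightarrow> l2_inner \<nu> u (kern l) = c l"
    and u_orth: "\<And>v. v \<in> L2 \<nu> \<Longrightarrow> (\<And>l. l \<in> \<Lambda> \<Longrightarrow> l2_inner \<nu> v (kern l) = 0) \<Longrightarrow> l2_inner \<nu> u v = 0"
    using min_norm_interpolantD[OF assms(16)] by blast
  have "\<exists>u. u \<in> L2 \<nu> \<and> gs n = synth u \<and> (\<forall>l\<in>\<Lambda>s n. l2_inner \<nu> u (kern l) = c l) \<and>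
      (\<forall>v. v \<in> L2 \<nu> \<longrightarrow> (\<forall>l\<in>\<Lambda>s n. l2_inner \<nu> v (kern l) = 0) \<longrightarrow> l2_inner \<nu> u v = 0)" for n
    by (rule min_norm_interpolantD[OF assms(17)[of n]]) blast
  then obtain un where un: "un n \<in> L2 \<nu>" and gs: "gs n = synth (un n)"
    and unc: "l \<in> \<Lambda>s n \<Longrightarrow> l2_inner \<nu> (un n) (kern l) = c l"
    and un_orth: "v \<in> L2 \<nu> \<Longrightarrow> (\<And>l. l \<in> \<Lambda>s n \<Longrightarrow> l2_inner \<nu> v (kern l) = 0) \<Longrightarrow>
        l2_inner \<nu> (un n) v = 0" for n l v
    by metis
  have sub: "\<Lambda>s n \<subseteq> \<Lambda>" for n using assms(14) by blast
  have proj: "gs n = harmonic_proj \<nu> w (translate_span (\<Lambda>s n) \<phi>) g" for n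
    unfolding g
  proof (rule harmonic_proj_eqI[OF u assms(8), symmetric])
    obtain a where "synth (un n) = (\<lambda>x. \<Sum>l\<in>\<Lambda>s n. a l * synth (kern l) x)"
      using min_norm_interpolant_in_span[OF assms(12) un un_orth] by blast
    then show "gs n \<in> translate_span (\<Lambda>s n) \<phi>"
      unfolding gs translate_span_def assms(8) translate_eq_synth_kern by blast
    show "synth u l = gs n l" if "l \<in> \<Lambda>s n" for l
      using that sub[of n] unc[OF that] uc[of l] by (auto simp: gs synth_eq_inner)
  qed
  have conv: "(\<lambda>n. l2_sq \<nu> (\<lambda>\<gamma>. u \<gamma> - un n \<gamma>)) \<longlonglongrightarrow> 0"
  proof (rule l2_interpolants_converge[where A = \<Lambda>s and e = kern and c = c])
    show "incseq \<Lambda>s" using assms(13) by (rule incseq_SucI)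
  qed (use kern_L2 un unc un_orth u uc u_orth assms(14) in auto)
  have diff: "(\<lambda>\<gamma>. u \<gamma> - un n \<gamma>) \<in> L2 \<nu>" for n using u un by (rule L2_diff)
  have gdiff: "(\<lambda>x. g x - gs n x) = synth (\<lambda>\<gamma>. u \<gamma> - un n \<gamma>)" for n
    by (simp add: g gs synth_diff u un)
  have norm: "(\<lambda>n. harmonic_norm \<nu> w (\<lambda>x. g x - gs n x)) \<longlonglongrightarrow> 0"
    using tendsto_real_sqrt[OF conv] by (simp add: gdiff harmonic_norm_synth diff)
  have "uniform_limit UNIV gs g sequentially"
  proof (rule uniform_limitI)
    fix \<epsilon> :: real assume \<epsilon>: "\<epsilon> > 0"
    define C where "C = l2_sq \<nu> (\<lambda>\<gamma>. of_real (inverse (w \<gamma>)))"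
    have "(\<lambda>n. l2_sq \<nu> (\<lambda>\<gamma>. u \<gamma> - un n \<gamma>) * C) \<longlonglongrightarrow> 0 * C"
      by (intro tendsto_mult conv tendsto_const)
    then have "\<forall>\<^sub>F n in sequentially. l2_sq \<nu> (\<lambda>\<gamma>. u \<gamma> - un n \<gamma>) * C < \<epsilon>\<^sup>2"
      using \<epsilon> by (intro order_tendstoD) auto
    then show "\<forall>\<^sub>F n in sequentially. \<forall>x\<in>UNIV. dist (gs n x) (g x) < \<epsilon>"
    proof eventually_elim
      case (elim n)
      have "dist (gs n x) (g x) < \<epsilon>" for x
      proof -
        have "(cmod (g x - gs n x))\<^sup>2 < \<epsilon>\<^sup>2"
          using norm_synth_le[OF diff[of n], of x] elim fun_cong[OF gdiff[of n], of x] by (simp add: C_def)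
        then have "cmod (g x - gs n x) < \<epsilon>"
          by (rule power2_less_imp_less) (use \<epsilon> in simp)
        then show ?thesis by (simp add: dist_norm norm_minus_commute)
      qed
      then show ?case by blast
    qed
  qed
  with proj norm show ?thesis by blast
qed

end
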